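(* Let $n\ge 1$ and $m\ge 0$ be integers, and let $\Psi_x\in\mathcal{Q}_{n,m}$ be positive semidefinite and bounded on the unit circle. Then the optimization problem $$\min_{\Psi_y,\Psi_z\in\mathcal{Q}_{n,m}}\ \operatorname{tr}\int_{-\pi}^{\pi}\Psi_y(e^{i\vartheta})\,\frac{\mathrm{d}\vartheta}{2\pi}\quad\text{subject to}\quad \Psi_y\succeq 0,\ \ \Psi_z\succeq 0,\ \ \Psi_z\text{ diagonal},\ \ \Psi_x=\Psi_y+\Psi_z$$ admits a solution, i.e. there is a feasible pair $(\Psi_y,\Psi_z)$ at which the minimum is attained.
   Context: $\mathcal{Q}_{n,m}$ denotes the real vector space of matrix pseudo-polynomials on the unit circle $$\mathcal{Q}_{n,m}=\Big\{\sum_{k=-m}^{m}e^{-ik\vartheta}Q_k \;:\; Q_k=Q_{-k}^T\in\mathbb{R}^{n\times n}\Big\},$$ regarded as $\mathbb{C}^{n\times n}$-valued functions of $e^{i\vartheta}$, $\vartheta\in[-\pi,\pi]$ (their values are Hermitian matrices). For such a function, $\Psi\succeq 0$ means that $\Psi(e^{i\vartheta})$ is positive semidefinite for every $\vartheta\in[-\pi,\pi]$, and "$\Psi$ diagonal" means that $\Psi(e^{i\vartheta})$ is a diagonal matrix for every $\vartheta$. *)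

theory Defs
  imports "HOL-Analysis.Analysis"
begin

(* Pseudo-polynomials are represented by the Laurent polynomials in z that they are
   on the unit circle, so that Psi (cis t) is the value at e^(i t). A Laurent polynomial
   is determined by its values on the circle; only those are referred to below. *)
definition pseudo_polys :: "nat \<Rightarrow> (complex \<Rightarrow> complex^'n^'n) set" where
  "pseudo_polys m =
     {\<Psi>. \<exists>Q :: int \<Rightarrow> real^'n^'n.
        (\<forall>k\<in>{- int m..int m}. Q k = transpose (Q (- k))) \<and>
        \<Psi> = (\<lambda>z. \<chi> i j. \<Sum>k = - int m..int m. z powi (- k) * complex_of_real (Q k $ i $ j))}"

definition hermitian :: "complex^'n^'n \<Rightarrow> bool" where
  "hermitian A \<longleftrightarrow> (\<forall>i j. A $ i $ j = cnj (A $ j $ i))"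

(* For Hermitian A the quadratic form is real, so taking Re loses nothing. *)
definition psd :: "complex^'n^'n \<Rightarrow> bool" where
  "psd A \<longleftrightarrow> hermitian A \<and> (\<forall>v. 0 \<le> Re (\<Sum>i\<in>UNIV. cnj (v $ i) * (A *v v) $ i))"

definition psd_on_circle :: "(complex \<Rightarrow> complex^'n^'n) \<Rightarrow> bool" where
  "psd_on_circle \<Psi> \<longleftrightarrow> (\<forall>\<theta>\<in>{-pi..pi}. psd (\<Psi> (cis \<theta>)))"

definition diagonal_on_circle :: "(complex \<Rightarrow> complex^'n^'n) \<Rightarrow> bool" where
  "diagonal_on_circle \<Psi> \<longleftrightarrow> (\<forall>\<theta>\<in>{-pi..pi}. \<forall>i j. i \<noteq> j \<longrightarrow> \<Psi> (cis \<theta>) $ i $ j = 0)"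

definition feasible ::
    "nat \<Rightarrow> (complex \<Rightarrow> complex^'n^'n) \<Rightarrow> (complex \<Rightarrow> complex^'n^'n) \<Rightarrow>
     (complex \<Rightarrow> complex^'n^'n) \<Rightarrow> bool" where
  "feasible m \<Psi>x \<Psi>y \<Psi>z \<longleftrightarrow>
     \<Psi>y \<in> pseudo_polys m \<and> \<Psi>z \<in> pseudo_polys m \<and>
     psd_on_circle \<Psi>y \<and> psd_on_circle \<Psi>z \<and> diagonal_on_circle \<Psi>z \<and>
     (\<forall>\<theta>\<in>{-pi..pi}. \<Psi>x (cis \<theta>) = \<Psi>y (cis \<theta>) + \<Psi>z (cis \<theta>))"

(* The trace is real for every pseudo-polynomial, since the values are Hermitian. *)
definition objective :: "(complex \<Rightarrow> complex^'n^'n) \<Rightarrow> real" where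
  "objective \<Psi> = Re (trace (integral {-pi..pi} (\<lambda>\<theta>. (1 / (2 * pi)) *\<^sub>R \<Psi> (cis \<theta>))))"

end

theory Submission imports Defs begin

text \<open>Since \<open>\<Psi>\<^sub>y = \<Psi>\<^sub>x - \<Psi>\<^sub>z\<close>, the problem is one about the coefficients of \<open>\<Psi>\<^sub>z\<close>
  alone. The diagonal entries of a feasible \<open>\<Psi>\<^sub>z\<close> lie between \<open>0\<close> and those of \<open>\<Psi>\<^sub>x\<close>,
  so its Fourier coefficients are bounded, and the coefficient families that satisfy the (closed)
  constraints form a compact set. On it the objective, being the trace of the zeroth
  coefficient of \<open>\<Psi>\<^sub>x - \<Psi>\<^sub>z\<close>, is continuous and hence attains its minimum.\<close>

section \<open>Pseudo-polynomials through their coefficients\<close>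

definition laurent_poly :: "nat \<Rightarrow> (int \<Rightarrow> real^'n^'n) \<Rightarrow> complex \<Rightarrow> complex^'n^'n" where
  "laurent_poly m Q z =
     (\<chi> i j. \<Sum>k = - int m..int m. z powi (- k) * complex_of_real (Q k $ i $ j))"

definition symmetric_coeffs :: "nat \<Rightarrow> (int \<Rightarrow> real^'n^'n) \<Rightarrow> bool" where
  "symmetric_coeffs m Q \<longleftrightarrow> (\<forall>k\<in>{- int m..int m}. Q k = transpose (Q (- k)))"

lemma pseudo_polys_iff:
  "\<Psi> \<in> pseudo_polys m \<longleftrightarrow> (\<exists>Q. symmetric_coeffs m Q \<and> \<Psi> = laurent_poly m Q)"
  unfolding pseudo_polys_def symmetric_coeffs_def laurent_poly_def by (simp add: fun_eq_iff)

lemma laurent_poly_diff: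
  "laurent_poly m (\<lambda>k. P k - Q k) z = laurent_poly m P z - laurent_poly m Q z"
  by (simp add: laurent_poly_def vec_eq_iff algebra_simps sum_subtractf)

lemma symmetric_coeffs_diff:
  fixes P Q :: "int \<Rightarrow> real^'n^'n"
  assumes "symmetric_coeffs m P" "symmetric_coeffs m Q"
  shows "symmetric_coeffs m (\<lambda>k. P k - Q k)"
  unfolding symmetric_coeffs_def
proof
  fix k assume "k \<in> {- int m..int m}"
  then have "P k = transpose (P (- k))" "Q k = transpose (Q (- k))"
    using assms unfolding symmetric_coeffs_def by blast+
  moreover have "transpose (A - B) = transpose A - transpose B" for A B :: "real^'n^'n"
    by (simp add: transpose_def vec_eq_iff)
  ultimately show "P k - Q k = transpose (P (- k) - Q (- k))" by simp
qed

text \<open>Only indices in the window enter the sum. This permits setting the other coefficients to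
  zero, without which a family representing a given function need not be bounded.\<close>

lemma laurent_poly_cong:
  "(\<And>k. k \<in> {- int m..int m} \<Longrightarrow> P k = Q k) \<Longrightarrow> laurent_poly m P = laurent_poly m Q"
  by (simp add: laurent_poly_def fun_eq_iff vec_eq_iff)

section \<open>Fourier coefficients and the objective\<close>

lemma has_integral_cis_int:
  "((\<lambda>\<theta>. cis (of_int k * \<theta>)) has_integral (if k = 0 then of_real (2 * pi) else 0)) {-pi..pi}"
proof (cases "k = 0")
  case True
  then show ?thesis
    using has_integral_const_real[of "1::complex" "-pi" pi] by (simp add: scaleR_conv_of_real)
next
  case False
  let ?F = "\<lambda>\<theta>. cis (of_int k * \<theta>) / (\<i> * of_int k)"
  have "((\<lambda>\<theta>. cis (of_int k * \<theta>)) has_integral (?F pi - ?F (-pi))) {-pi..pi}"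
  proof (rule fundamental_theorem_of_calculus)
    fix x :: real
    have "((\<lambda>\<theta>. exp (\<i> * of_int k * of_real \<theta>) / (\<i> * of_int k))
        has_vector_derivative exp (\<i> * of_int k * of_real x)) (at x within {-pi..pi})"
      using False by (auto intro!: derivative_eq_intros has_vector_derivative_real_field)
    then show "(?F has_vector_derivative cis (of_int k * x)) (at x within {-pi..pi})"
      by (simp add: cis_conv_exp mult.assoc)
  qed simp
  \<comment> \<open>The boundary terms of the antiderivative cancel: cosine is even and sine
    vanishes at integer multiples of pi.\<close>
  moreover have "cis (of_int k * pi) = cis (of_int k * (- pi))"
    by (simp add: complex_eq_iff sin_times_pi_eq_0)
  ultimately show ?thesis using False by simp
qed

text \<open>The factor \<open>cis (of_int k * \<theta>)\<close> turns the term of index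
  \<open>k\<close> into a constant; every other term becomes a nontrivial character and integrates
  to zero.\<close>

lemma has_integral_fourier_coeff:
  assumes "k \<in> {- int m..int m}"
  shows "((\<lambda>\<theta>. cis (of_int k * \<theta>) * laurent_poly m Q (cis \<theta>) $ i $ j)
    has_integral of_real (2 * pi * Q k $ i $ j)) {-pi..pi}"
proof -
  have "((\<lambda>\<theta>. \<Sum>l = - int m..int m. cis (of_int (k - l) * \<theta>) * of_real (Q l $ i $ j))
     has_integral (\<Sum>l = - int m..int m.
       (if k - l = 0 then of_real (2 * pi) else 0) * of_real (Q l $ i $ j))) {-pi..pi}"
    by (intro has_integral_sum has_integral_mult_left has_integral_cis_int) auto
  moreover have "(\<Sum>l = - int m..int m.
       (if k - l = 0 then of_real (2 * pi) else 0) * complex_of_real (Q l $ i $ j))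
     = of_real (2 * pi * Q k $ i $ j)"
  proof -
    have "(if k - l = 0 then of_real (2 * pi) else 0) * complex_of_real (Q l $ i $ j)
        = (if k = l then of_real (2 * pi * Q l $ i $ j) else 0)" for l
      by simp
    then show ?thesis using assms by simp
  qed
  moreover have "cis (of_int k * \<theta>) * laurent_poly m Q (cis \<theta>) $ i $ j =
      (\<Sum>l = - int m..int m. cis (of_int (k - l) * \<theta>) * of_real (Q l $ i $ j))" for \<theta>
  proof -
    have "cis (of_int k * \<theta>) * (cis \<theta> powi (- l)) = cis (of_int (k - l) * \<theta>)" for l
      by (simp add: cis_power_int cis_mult algebra_simps)
    then show ?thesis
      unfolding laurent_poly_def vec_lambda_beta sum_distrib_left mult.assoc[symmetric] by simp
  qed
  ultimately show ?thesis by (simp only:)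
qed

text \<open>A coefficient is a mean over the circle of the entry times a factor of modulus one, so
  it inherits any bound on the entry.\<close>

lemma laurent_coeff_bound:
  assumes "k \<in> {- int m..int m}"
    and "\<And>\<theta>. \<theta> \<in> {-pi..pi} \<Longrightarrow> norm (laurent_poly m Q (cis \<theta>) $ i $ j) \<le> C"
  shows "\<bar>Q k $ i $ j\<bar> \<le> C"
proof -
  have "0 \<le> C" using order_trans[OF norm_ge_zero assms(2)[of 0]] by simp
  then have "norm (complex_of_real (2 * pi * Q k $ i $ j)) \<le> C * measure lborel {-pi..pi}"
    by (rule has_integral_bound_real[OF _ finite.emptyI has_integral_fourier_coeff[OF assms(1)]])
      (use assms(2) in \<open>auto simp: norm_mult\<close>)
  then have "(2 * pi) * \<bar>Q k $ i $ j\<bar> \<le> (2 * pi) * C"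
    by (simp add: norm_mult abs_mult mult.commute)
  then show ?thesis by simp
qed

lemma continuous_on_laurent_poly_cis:
  "continuous_on S (\<lambda>\<theta>. laurent_poly m Q (cis \<theta>))"
  unfolding laurent_poly_def by (intro continuous_intros) auto

text \<open>The trace is bounded linear and so commutes with the integral; the mean of each diagonal
  entry is its zeroth Fourier coefficient.\<close>

lemma objective_laurent_poly: "objective (laurent_poly m Q) = trace (Q 0)"
proof -
  let ?f = "\<lambda>\<theta>. (1 / (2 * pi)) *\<^sub>R laurent_poly m Q (cis \<theta>)"
  have lin: "bounded_linear (trace :: complex^'n^'n \<Rightarrow> complex)"
    unfolding trace_def
    by (intro bounded_linear_sum bounded_linear_compose[OF bounded_linear_vec_nth]
        bounded_linear_vec_nth)
  have "?f integrable_on {-pi..pi}"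
    by (intro integrable_continuous_real continuous_intros continuous_on_laurent_poly_cis)
  then have "trace (integral {-pi..pi} ?f) = integral {-pi..pi} (trace \<circ> ?f)"
    by (rule integral_linear[OF _ lin, symmetric])
  \<comment> \<open>The trivial factor \<open>cis (of_int 0 * \<theta>)\<close> is kept so that
    \<open>has_integral_fourier_coeff\<close> applies with \<open>k = 0\<close>.\<close>
  also have "trace \<circ> ?f = (\<lambda>\<theta>. \<Sum>i\<in>UNIV.
      (1 / (2 * pi)) *\<^sub>R (cis (of_int 0 * \<theta>) * laurent_poly m Q (cis \<theta>) $ i $ i))"
    by (simp add: trace_def fun_eq_iff)
  also have "integral {-pi..pi} \<dots> =
      (\<Sum>i\<in>UNIV. (1 / (2 * pi)) *\<^sub>R of_real (2 * pi * Q 0 $ i $ i))"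
    by (intro integral_unique has_integral_sum has_integral_cmul has_integral_fourier_coeff) auto
  finally show ?thesis
    by (simp add: objective_def trace_def scaleR_conv_of_real)
qed

text \<open>Feasibility imposes the decomposition of \<open>\<Psi>x\<close> on the circle only, so
  objectives have to be compared through values there.\<close>

lemma objective_cong:
  "(\<And>\<theta>. \<theta> \<in> {-pi..pi} \<Longrightarrow> \<Phi> (cis \<theta>) = \<Psi> (cis \<theta>)) \<Longrightarrow> objective \<Phi> = objective \<Psi>"
  unfolding objective_def by (metis (no_types, lifting) integral_cong)

section \<open>Positive semidefinite matrices\<close>

lemma psd_0: "psd 0"
  by (simp add: psd_def hermitian_def)

text \<open>The quadratic form at the basis vector \<open>axis i 1\<close> is the diagonal entry; it
  is real because the matrix is Hermitian.\<close>

lemma psd_diag_entry: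
  assumes "psd A" shows "0 \<le> Re (A $ i $ i)" "Im (A $ i $ i) = 0"
proof -
  have "0 \<le> Re (\<Sum>k\<in>UNIV. cnj (axis i 1 $ k) * (A *v axis i 1) $ k)"
    using assms by (simp only: psd_def)
  also have "(\<Sum>k\<in>UNIV. cnj (axis i 1 $ k) * (A *v axis i 1) $ k) = A $ i $ i"
    by (simp add: axis_def matrix_vector_mult_def if_distrib[of "\<lambda>x. x * _"]
        if_distrib[of "\<lambda>x. _ * x"] if_distrib[of cnj] sum.delta cong: if_cong)
  finally show "0 \<le> Re (A $ i $ i)" .
  have "A $ i $ i = cnj (A $ i $ i)" using assms unfolding psd_def hermitian_def by blast
  from arg_cong[OF this, of Im] show "Im (A $ i $ i) = 0" by simp
qed

text \<open>For fixed indices and a fixed vector, each condition is an equation or a weak inequality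
  between continuous functions of the matrix.\<close>

lemma closed_psd: "closed {A. psd A}"
  unfolding psd_def hermitian_def matrix_vector_mult_def
  by (intro closed_Collect_conj closed_Collect_all closed_Collect_eq closed_Collect_le
      continuous_intros)

text \<open>On the diagonal, \<open>Y\<close> only adds a nonnegative real to the nonnegative entry
  of \<open>Z\<close>; off the diagonal \<open>Z\<close> vanishes.\<close>

lemma diagonal_psd_summand_bound:
  assumes "psd Y" "psd Z" "\<And>i j. i \<noteq> j \<Longrightarrow> Z $ i $ j = 0"
  shows "norm (Z $ i $ j) \<le> norm (Y + Z)"
proof (cases "i = j")
  case True
  have "norm (Z $ i $ i) = Re (Z $ i $ i)"
    using psd_diag_entry[OF assms(2)] by (simp add: cmod_eq_Re)
  also have "\<dots> \<le> Re ((Y + Z) $ i $ i)" using psd_diag_entry[OF assms(1)] by simp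
  also have "\<dots> \<le> norm ((Y + Z) $ i $ i)" by (rule complex_Re_le_cmod)
  also have "\<dots> \<le> norm (Y + Z)"
    by (rule order_trans[OF Finite_Cartesian_Product.norm_nth_le
          Finite_Cartesian_Product.norm_nth_le])
  finally show ?thesis using True by simp
qed (simp add: assms)

section \<open>Topology and norms of coefficient families\<close>

lemma continuous_on_laurent_poly_coeffs:
  "continuous_on UNIV (\<lambda>Q. laurent_poly m Q z)"
  unfolding laurent_poly_def
  by (intro continuous_intros continuous_on_product_coordinates)

text \<open>Tychonoff: in the product topology on functions, this set is a product of closed balls,
  each compact in finite dimension.\<close>

lemma compact_pointwise_norm_bounded:
  "compact {Q :: 'a \<Rightarrow> 'b::euclidean_space. \<forall>k. norm (Q k) \<le> C}"
proof -
  have "compactin (product_topology (\<lambda>_::'a. euclidean::'b topology) UNIV)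
          (PiE UNIV (\<lambda>_. cball 0 C))"
    by (simp add: compactin_PiE)
  moreover have "PiE UNIV (\<lambda>_. cball 0 C) = {Q :: 'a \<Rightarrow> 'b. \<forall>k. norm (Q k) \<le> C}"
    by (auto simp: PiE_def Pi_def)
  ultimately show ?thesis
    by (simp add: euclidean_product_topology)
qed

text \<open>The Euclidean norm is at most the l1 norm, applied first within each row and then to the
  vector of row norms.\<close>

lemma norm_matrix_le:
  fixes A :: "real^'n^'m"
  assumes "\<And>i j. \<bar>A $ i $ j\<bar> \<le> C"
  shows "norm A \<le> real CARD('m) * (real CARD('n) * C)"
proof -
  have "norm (A $ i) \<le> real CARD('n) * C" for i
    using norm_le_l1_cart[of "A $ i"] sum_mono[of UNIV "\<lambda>j. \<bar>A $ i $ j\<bar>" "\<lambda>_. C"] assms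
    by simp
  then have "(\<Sum>i\<in>UNIV. norm (A $ i)) \<le> real CARD('m) * (real CARD('n) * C)"
    using sum_mono[of UNIV "\<lambda>i. norm (A $ i)" "\<lambda>_. real CARD('n) * C"] by simp
  then show ?thesis
    unfolding norm_vec_def[of A]
    using L2_set_le_sum[of UNIV "\<lambda>i. norm (A $ i)"] by force
qed

section \<open>Existence of a minimizer\<close>

theorem proposition4p2:
  fixes m :: nat and \<Psi>x :: "complex \<Rightarrow> complex^'n^'n"
  assumes "\<Psi>x \<in> pseudo_polys m"
    and "psd_on_circle \<Psi>x"
    and "bounded ((\<lambda>\<theta>. \<Psi>x (cis \<theta>)) ` {-pi..pi})"
  shows "\<exists>\<Psi>y \<Psi>z. feasible m \<Psi>x \<Psi>y \<Psi>z \<and>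
           (\<forall>\<Psi>y' \<Psi>z'. feasible m \<Psi>x \<Psi>y' \<Psi>z' \<longrightarrow> objective \<Psi>y \<le> objective \<Psi>y')"
proof -
  obtain P where P: "symmetric_coeffs m P" "\<Psi>x = laurent_poly m P"
    using assms(1) by (auto simp: pseudo_polys_iff)
  obtain C where C: "\<And>\<theta>. \<theta> \<in> {-pi..pi} \<Longrightarrow> norm (\<Psi>x (cis \<theta>)) \<le> C"
    using assms(3) unfolding bounded_iff by blast
  have "0 \<le> C" using order_trans[OF norm_ge_zero C[of 0]] by simp
  \<comment> \<open>The constant that \<open>norm_matrix_le\<close> yields for a square matrix with
    entries bounded by \<open>C\<close>.\<close>
  define B where "B = real CARD('n) * (real CARD('n) * C)"
  have "0 \<le> B" using \<open>0 \<le> C\<close> by (simp add: B_def)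
  \<comment> \<open>\<open>\<Psi>y\<close> is eliminated: its positivity becomes the last condition
    on \<open>Q\<close>.\<close>
  define K :: "(int \<Rightarrow> real^'n^'n) set" where "K = {Q. symmetric_coeffs m Q \<and>
      psd_on_circle (laurent_poly m Q) \<and> diagonal_on_circle (laurent_poly m Q) \<and>
      psd_on_circle (\<lambda>z. \<Psi>x z - laurent_poly m Q z)}"
  define F where "F = {Q. \<forall>k. norm (Q k) \<le> B} \<inter> K"
  define J where "J = (\<lambda>Q :: int \<Rightarrow> real^'n^'n. trace (P 0 - Q 0))"
  have closed_psd_vimage: "closed {Q. psd (g Q)}"
    if "continuous_on UNIV g" for g :: "(int \<Rightarrow> real^'n^'n) \<Rightarrow> complex^'n^'n"
    using closed_vimage[OF closed_psd that] by (simp add: vimage_def)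
  \<comment> \<open>The bounded quantifiers become implications whose premises do not depend on
    \<open>Q\<close>, so they preserve closedness.\<close>
  have "closed K"
    unfolding K_def symmetric_coeffs_def psd_on_circle_def diagonal_on_circle_def
      Ball_def transpose_def
    by (intro closed_Collect_conj closed_Collect_all closed_Collect_imp open_Collect_const
        closed_Collect_eq closed_psd_vimage continuous_intros continuous_on_product_coordinates
        continuous_on_laurent_poly_coeffs)
  then have "compact F"
    unfolding F_def by (intro compact_Int_closed compact_pointwise_norm_bounded)
  \<comment> \<open>Nonemptiness comes from the trivial decomposition with \<open>\<Psi>z\<close>
    zero and \<open>\<Psi>y\<close> equal to \<open>\<Psi>x\<close>; this uses positivity of
    \<open>\<Psi>x\<close>.\<close>
  moreover have "(\<lambda>_. 0) \<in> F"
  proof -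
    have "laurent_poly m (\<lambda>_. 0) z = (0 :: complex^'n^'n)" for z
      by (simp add: laurent_poly_def vec_eq_iff)
    moreover have "transpose 0 = (0 :: real^'n^'n)"
      by (simp add: transpose_def vec_eq_iff)
    ultimately show ?thesis
      using assms(2) \<open>0 \<le> B\<close>
      by (simp add: F_def K_def symmetric_coeffs_def psd_on_circle_def diagonal_on_circle_def
          psd_0)
  qed
  moreover have "continuous_on F J"
  proof (rule continuous_on_subset)
    show "continuous_on UNIV J"
      unfolding J_def trace_def
      by (intro continuous_intros continuous_on_product_coordinates)
  qed simp
  ultimately have "\<exists>Q\<in>F. \<forall>R\<in>F. J Q \<le> J R" by (intro continuous_attains_inf) auto
  then obtain Q where Q: "Q \<in> F" and Q_min: "\<And>R. R \<in> F \<Longrightarrow> J Q \<le> J R"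
    by blast
  \<comment> \<open>Agreement on the circle suffices here, so the same identity serves the minimizer
    and an arbitrary competitor.\<close>
  have objective_J: "objective \<Phi> = J R"
    if "\<And>\<theta>. \<theta> \<in> {-pi..pi} \<Longrightarrow> \<Phi> (cis \<theta>) = \<Psi>x (cis \<theta>) - laurent_poly m R (cis \<theta>)" for \<Phi> R
  proof -
    have "objective \<Phi> = objective (laurent_poly m (\<lambda>k. P k - R k))"
      using that by (intro objective_cong) (simp add: laurent_poly_diff P(2))
    then show ?thesis by (simp add: objective_laurent_poly J_def)
  qed
  let ?\<Psi>y = "\<lambda>z. \<Psi>x z - laurent_poly m Q z"
  have "?\<Psi>y = laurent_poly m (\<lambda>k. P k - Q k)" by (simp add: laurent_poly_diff P(2) fun_eq_iff)
  then have "?\<Psi>y \<in> pseudo_polys m"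
    using Q P(1) symmetric_coeffs_diff[of m P Q]
    unfolding F_def K_def pseudo_polys_iff by blast
  moreover have "laurent_poly m Q \<in> pseudo_polys m"
    using Q unfolding F_def K_def pseudo_polys_iff by blast
  ultimately have "feasible m \<Psi>x ?\<Psi>y (laurent_poly m Q)"
    using Q by (simp add: F_def K_def feasible_def)
  \<comment> \<open>Minimality over \<open>F\<close> covers every competitor once its
    \<open>\<Psi>z'\<close> is represented by a family in \<open>F\<close>.\<close>
  moreover have "objective ?\<Psi>y \<le> objective \<Psi>y'" if feas: "feasible m \<Psi>x \<Psi>y' \<Psi>z'" for \<Psi>y' \<Psi>z'
  proof -
    obtain R' where R': "symmetric_coeffs m R'" "\<Psi>z' = laurent_poly m R'"
      using feas by (auto simp: feasible_def pseudo_polys_iff)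
    \<comment> \<open>The coefficients outside the range are arbitrary; only after truncation are they bounded.\<close>
    define R where "R = (\<lambda>k. if k \<in> {- int m..int m} then R' k else 0)"
    have "laurent_poly m R = laurent_poly m R'"
      by (rule laurent_poly_cong) (simp add: R_def)
    then have R: "\<Psi>z' = laurent_poly m R" using R'(2) by simp
    have sym: "symmetric_coeffs m R"
      unfolding symmetric_coeffs_def
    proof
      fix k assume "k \<in> {- int m..int m}"
      \<comment> \<open>The window is symmetric about zero, so truncation keeps both
        \<open>k\<close> and its negative and preserves the symmetry.\<close>
      moreover from this have "- k \<in> {- int m..int m}" by simp
      ultimately show "R k = transpose (R (- k))"
        using R'(1) unfolding symmetric_coeffs_def R_def by metis
    qed
    have psd_y: "psd_on_circle \<Psi>y'" and psd_z: "psd_on_circle (laurent_poly m R)"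
      and diag: "diagonal_on_circle (laurent_poly m R)"
      and split: "\<And>\<theta>. \<theta> \<in> {-pi..pi} \<Longrightarrow> \<Psi>x (cis \<theta>) = \<Psi>y' (cis \<theta>) + laurent_poly m R (cis \<theta>)"
      using feas unfolding feasible_def R by blast+
    have bound: "norm (laurent_poly m R (cis \<theta>) $ i $ j) \<le> C" if "\<theta> \<in> {-pi..pi}" for \<theta> i j
    proof -
      have "norm (laurent_poly m R (cis \<theta>) $ i $ j)
          \<le> norm (\<Psi>y' (cis \<theta>) + laurent_poly m R (cis \<theta>))"
        using psd_y psd_z diag that
        unfolding psd_on_circle_def diagonal_on_circle_def
        by (intro diagonal_psd_summand_bound) blast+
      then show ?thesis using C[OF that] split[OF that] by simp
    qed
    have "\<bar>R k $ i $ j\<bar> \<le> C" for k i j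
    proof (cases "k \<in> {- int m..int m}")
      case True
      then show ?thesis using bound by (rule laurent_coeff_bound)
    next
      case False
      then have "R k = 0" unfolding R_def by (rule if_not_P)
      then show ?thesis using \<open>0 \<le> C\<close> by simp
    qed
    then have "norm (R k) \<le> B" for k
      unfolding B_def by (rule norm_matrix_le)
    \<comment> \<open>On the circle, \<open>\<Psi>x\<close> minus \<open>laurent_poly m R\<close> is
      \<open>\<Psi>y'\<close>, which supplies the last condition of \<open>K\<close>.\<close>
    moreover have "R \<in> K"
      using sym psd_y psd_z diag split by (simp add: K_def psd_on_circle_def)
    ultimately have "J Q \<le> J R" by (intro Q_min) (simp add: F_def)
    moreover have "objective \<Psi>y' = J R" using split by (intro objective_J) simp
    ultimately show ?thesis using objective_J[of ?\<Psi>y Q] by simp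
  qed
  ultimately show ?thesis by blast
qed

end
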